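(* Let $k \ge 3$ and let $G$ be a $(k+1)$-critical graph. Then $G$ contains at least $k!/2$ cycles whose length is congruent to $1 \bmod k$, with equality only when $G$ is the complete graph $K_{k+1}$.
   Context: A graph $G$ is $(k+1)$-critical if its chromatic number is $k+1$ but every proper subgraph of $G$ has chromatic number at most $k$. Cycles are counted as subgraphs. *)

theory Defs
  imports Complex_Main "HOL-Number_Theory.Cong"
begin

type_synonym 'a ugraph = "'a set \<times> 'a set set"

abbreviation verts :: "'a ugraph \<Rightarrow> 'a set" where
  "verts G \<equiv> fst G"

abbreviation edges :: "'a ugraph \<Rightarrow> 'a set set" where
  "edges G \<equiv> snd G"

definition finite_simple_graph :: "'a ugraph \<Rightarrow> bool" where
  "finite_simple_graph G \<longleftrightarrow>
     finite (verts G) \<and> (\<forall>e \<in> edges G. e \<subseteq> verts G \<and> card e = 2)"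

text \<open>Subgraphs need not be induced or spanning, and may have no vertices.\<close>

definition subgraph_of :: "'a ugraph \<Rightarrow> 'a ugraph \<Rightarrow> bool" where
  "subgraph_of H G \<longleftrightarrow>
     finite_simple_graph H \<and> verts H \<subseteq> verts G \<and> edges H \<subseteq> edges G"

definition proper_colouring :: "'a ugraph \<Rightarrow> nat \<Rightarrow> ('a \<Rightarrow> nat) \<Rightarrow> bool" where
  "proper_colouring G n c \<longleftrightarrow>
     (\<forall>v \<in> verts G. c v < n) \<and> (\<forall>u v. {u, v} \<in> edges G \<longrightarrow> c u \<noteq> c v)"

definition chromatic_number :: "'a ugraph \<Rightarrow> nat" where
  "chromatic_number G = (LEAST n. \<exists>c. proper_colouring G n c)"

definition critical_graph :: "nat \<Rightarrow> 'a ugraph \<Rightarrow> bool" where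
  "critical_graph n G \<longleftrightarrow>
     finite_simple_graph G \<and> chromatic_number G = n \<and>
     (\<forall>H. subgraph_of H G \<and> H \<noteq> G \<longrightarrow> chromatic_number H < n)"

definition cycle_graph :: "'a list \<Rightarrow> 'a ugraph" where
  "cycle_graph vs =
     (set vs, {{vs ! i, vs ! (Suc i mod length vs)} | i. i < length vs})"

text \<open>
  A cycle is the graph traced out by a cyclic sequence of distinct vertices, so the choice of
  starting vertex and of orientation is forgotten, and cycles are counted as subgraphs.
\<close>

definition is_cycle :: "'a ugraph \<Rightarrow> bool" where
  "is_cycle C \<longleftrightarrow> (\<exists>vs. 3 \<le> length vs \<and> distinct vs \<and> C = cycle_graph vs)"

definition cycle_length :: "'a ugraph \<Rightarrow> nat" where
  "cycle_length C = card (edges C)"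

definition cycles_cong_one :: "nat \<Rightarrow> 'a ugraph \<Rightarrow> 'a ugraph set" where
  "cycles_cong_one k G =
     {C. subgraph_of C G \<and> is_cycle C \<and> [cycle_length C = 1] (mod k)}"

definition is_complete_graph :: "nat \<Rightarrow> 'a ugraph \<Rightarrow> bool" where
  "is_complete_graph n G \<longleftrightarrow>
     finite (verts G) \<and> card (verts G) = n \<and> edges G = {e. e \<subseteq> verts G \<and> card e = 2}"

end

theory Submission
  imports Defs "HOL-Combinatorics.Multiset_Permutations"
begin

text \<open>
  Let \<open>f\<close> be a \<open>k\<close>-colouring of \<open>G - xy\<close>; then \<open>f x = f y\<close>. For every cyclic ordering of the
  colours, \<open>y\<close> is reachable from \<open>x\<close> along edges of \<open>G - xy\<close> that advance the colour by one step:
  otherwise advancing the colour of every reachable vertex gives a \<open>k\<close>-colouring of \<open>G\<close>. Such a path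
  has length divisible by \<open>k\<close> and determines the cyclic ordering, so every edge lies in at least
  \<open>(k - 1)!\<close> cycles of length 1 modulo \<open>k\<close>. Every vertex has degree at least \<open>k\<close>, and counting the
  cycles through one vertex gives the bound.

  In the case of equality \<open>G\<close> is \<open>k\<close>-regular and all these cycles are Hamiltonian. Moreover every
  colouring of \<open>G - xy\<close> arises periodically along one and the same cycle, so \<open>G - xy\<close> is uniquely
  \<open>k\<close>-colourable. By Kempe changes any two colour classes induce a connected graph, whence
  \<open>G - xy\<close> has at least \<open>(k - 1) n - k (k - 1) / 2\<close> edges. As \<open>G\<close> has \<open>k n / 2\<close> edges, \<open>n \<le> k + 1\<close>.
\<close>

section \<open>Cycles\<close>

lemma edges_cycle_graph:
  "edges (cycle_graph vs) = (\<lambda>i. {vs ! i, vs ! (Suc i mod length vs)}) ` {..<length vs}"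
  by (auto simp: cycle_graph_def)

lemma verts_cycle_graph: "verts (cycle_graph vs) = set vs"
  by (simp add: cycle_graph_def)

lemma Suc_mod_cases:
  assumes "i < n"
  obtains "Suc i < n" "Suc i mod n = Suc i" | "i = n - 1" "Suc i mod n = 0"
proof (cases "Suc i = n")
  case True
  then show ?thesis using that(2) by auto
next
  case False
  then show ?thesis using that(1) assms by auto
qed

lemma Suc_mod_less: "i < n \<Longrightarrow> Suc i mod n < n"
  by simp

text \<open>Distinct positions index distinct edges: if \<open>i \<noteq> j\<close> gave the same
  edge, each would be the cyclic successor of the other, which is impossible from length 3
  on.\<close>

lemma cycle_length_cycle_graph:
  assumes "distinct vs" "3 \<le> length vs"
  shows "cycle_length (cycle_graph vs) = length vs"
proof -
  let ?n = "length vs"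
  have "inj_on (\<lambda>i. {vs ! i, vs ! (Suc i mod ?n)}) {..<?n}"
  proof (rule inj_onI)
    fix i j
    assume ij: "i \<in> {..<?n}" "j \<in> {..<?n}"
      and eq: "{vs ! i, vs ! (Suc i mod ?n)} = {vs ! j, vs ! (Suc j mod ?n)}"
    have m: "Suc i mod ?n < ?n" "Suc j mod ?n < ?n" using ij by (simp_all add: Suc_mod_less)
    show "i = j"
    proof (rule ccontr)
      assume "i \<noteq> j"
      then have "vs ! i \<noteq> vs ! j" using ij assms(1) by (simp add: nth_eq_iff_index_eq)
      then have "vs ! i = vs ! (Suc j mod ?n)" "vs ! j = vs ! (Suc i mod ?n)"
        using eq by (auto simp: doubleton_eq_iff)
      then have "i = Suc j mod ?n" "j = Suc i mod ?n"
        using ij m assms(1) by (simp_all add: nth_eq_iff_index_eq)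
      moreover have "i < ?n" "j < ?n" using ij by auto
      ultimately show False
        using assms(2) by (elim Suc_mod_cases[of i ?n] Suc_mod_cases[of j ?n]) linarith+
    qed
  qed
  then show ?thesis unfolding cycle_length_def edges_cycle_graph by (simp add: card_image)
qed

text \<open>A vertex at position \<open>i\<close> lies only on the edges indexed by \<open>i\<close>
  and by its cyclic predecessor.\<close>

lemma card_cycle_graph_incident_le:
  assumes "distinct vs" "3 \<le> length vs"
  shows "card {e \<in> edges (cycle_graph vs). v \<in> e} \<le> 2"
proof (cases "v \<in> set vs")
  case False
  have "e \<subseteq> set vs" if "e \<in> edges (cycle_graph vs)" for e
  proof -
    obtain i where "i < length vs" "e = {vs ! i, vs ! (Suc i mod length vs)}"
      using \<open>e \<in> edges (cycle_graph vs)\<close> unfolding edges_cycle_graph by auto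
    moreover from \<open>i < length vs\<close> have "Suc i mod length vs < length vs" by (rule Suc_mod_less)
    ultimately show ?thesis by (auto intro: nth_mem)
  qed
  with False have "{e \<in> edges (cycle_graph vs). v \<in> e} = {}" by auto
  then show ?thesis by (metis card.empty zero_le)
next
  case True
  let ?n = "length vs"
  let ?E = "\<lambda>i. {vs ! i, vs ! (Suc i mod ?n)}"
  obtain i where i: "i < ?n" "v = vs ! i" using True by (auto simp: in_set_conv_nth)
  define j where "j = (if i = 0 then ?n - 1 else i - 1)"
  have "{e \<in> edges (cycle_graph vs). v \<in> e} \<subseteq> {?E i, ?E j}"
  proof
    fix e assume "e \<in> {e \<in> edges (cycle_graph vs). v \<in> e}"
    then obtain l where l: "l < ?n" "e = ?E l" "v \<in> ?E l" unfolding edges_cycle_graph by auto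
    have "Suc l mod ?n < ?n" using l(1) by (rule Suc_mod_less)
    then have "i = l \<or> i = Suc l mod ?n"
      using l i assms(1) by (auto simp: nth_eq_iff_index_eq)
    then have "l = i \<or> l = j"
      using l(1) by (auto simp: j_def elim!: Suc_mod_cases[of l ?n])
    then show "e \<in> {?E i, ?E j}" using l by auto
  qed
  then have "card {e \<in> edges (cycle_graph vs). v \<in> e} \<le> card {?E i, ?E j}"
    by (intro card_mono) auto
  also have "\<dots> \<le> 2" by (simp add: card_insert_if)
  finally show ?thesis .
qed

text \<open>A cycle as a graph forgets starting vertex and orientation. The first vertex of the list
  fixes the former, and the last, one of its two neighbours, fixes the latter. This recovers a path
  from the cycle it closes up to.\<close>

lemma cycle_graph_inj:
  assumes P: "distinct P" "3 \<le> length P" and Q: "distinct Q"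
    and eq: "cycle_graph P = cycle_graph Q"
    and hd: "hd P = hd Q" and last: "last P = last Q"
  shows "P = Q"
proof -
  let ?n = "length P"
  have "set P = set Q" using eq by (metis verts_cycle_graph)
  then have len: "length Q = ?n" using P(1) Q by (metis distinct_card)
  have ne: "P \<noteq> []" "Q \<noteq> []" using P(2) len by auto
  have "\<forall>j\<le>i. j < ?n \<longrightarrow> P ! j = Q ! j" for i
  proof (induction i)
    case 0
    then show ?case using hd ne by (simp add: hd_conv_nth)
  next
    case (Suc i)
    have "P ! Suc i = Q ! Suc i" if Suc_less: "Suc i < ?n"
    proof -
      from that Suc.IH have i: "i < ?n" "P ! i = Q ! i" by auto
      have "{P ! i, P ! (Suc i mod ?n)} \<in> edges (cycle_graph P)"
        unfolding edges_cycle_graph using i by blast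
      then have "{P ! i, P ! Suc i} \<in> edges (cycle_graph Q)" using eq Suc_less by simp
      then obtain j where j: "j < ?n" "{P ! i, P ! Suc i} = {Q ! j, Q ! (Suc j mod ?n)}"
        unfolding edges_cycle_graph len by auto
      have m: "Suc j mod ?n < ?n" using j(1) by (rule Suc_mod_less)
      show ?thesis
      proof (cases "j = i")
        case True
        then show ?thesis using j(2) i Suc_less by (auto simp: doubleton_eq_iff)
      next
        \<comment> \<open>Now \<open>P ! Suc i\<close> precedes \<open>P ! i\<close> on
          \<open>Q\<close>, so it is an earlier vertex of \<open>P\<close> or, for
          \<open>i = 0\<close>, the common last vertex. Distinctness and length at least 3 exclude
          both.\<close>
        case False
        then have "Q ! j \<noteq> Q ! i" using i(1) j(1) Q len by (simp add: nth_eq_iff_index_eq)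
        then have "Q ! (Suc j mod ?n) = Q ! i" and PQ: "P ! Suc i = Q ! j"
          using j(2) i(2) by (auto simp: doubleton_eq_iff)
        then have si: "Suc j mod ?n = i" using i(1) m Q len by (simp add: nth_eq_iff_index_eq)
        show ?thesis
          using j(1)
        proof (cases rule: Suc_mod_cases)
          case 1
          then have "P ! j = P ! Suc i" using si PQ Suc.IH j(1) by simp
          then show ?thesis using P(1) Suc_less j(1) si 1 by (simp add: nth_eq_iff_index_eq)
        next
          case 2
          then have "P ! j = P ! Suc i" using PQ last ne len by (simp add: last_conv_nth)
          then show ?thesis
            using P Suc_less j(1) si 2 by (simp add: nth_eq_iff_index_eq)
        qed
      qed
    qed
    then show ?case using Suc.IH by (auto simp: le_Suc_eq)
  qed
  then show ?thesis using len by (metis nth_equalityI order_refl)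
qed

text \<open>If the next vertex already lies on the path built so far, the path is cut back there;
  otherwise the vertex is appended.\<close>

lemma rtrancl_distinct_path:
  assumes "(x, y) \<in> r\<^sup>*"
  shows "\<exists>P. P \<noteq> [] \<and> distinct P \<and> hd P = x \<and> last P = y \<and>
    (\<forall>i. Suc i < length P \<longrightarrow> (P ! i, P ! Suc i) \<in> r)"
  using assms
proof (induction rule: rtrancl_induct)
  case base
  show ?case by (rule exI[of _ "[x]"]) auto
next
  case (step u w)
  then obtain P where P: "P \<noteq> []" "distinct P" "hd P = x" "last P = u"
    "\<And>i. Suc i < length P \<Longrightarrow> (P ! i, P ! Suc i) \<in> r" by blast
  show ?case
  proof (cases "w \<in> set P")
    case True
    then obtain j where j: "j < length P" "w = P ! j" by (auto simp: in_set_conv_nth)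
    show ?thesis
    proof (intro exI conjI allI impI)
      show "take (Suc j) P \<noteq> []" "distinct (take (Suc j) P)" "hd (take (Suc j) P) = x"
        using P by auto
      show "last (take (Suc j) P) = w" using j by (simp add: take_Suc_conv_app_nth)
      show "(take (Suc j) P ! i, take (Suc j) P ! Suc i) \<in> r"
        if "Suc i < length (take (Suc j) P)" for i
        using that P(5) by simp
    qed
  next
    case False
    show ?thesis
    proof (intro exI conjI allI impI)
      show "P @ [w] \<noteq> []" "distinct (P @ [w])" "hd (P @ [w]) = x" "last (P @ [w]) = w"
        using P False by auto
      show "((P @ [w]) ! i, (P @ [w]) ! Suc i) \<in> r" if "Suc i < length (P @ [w])" for i
      proof (cases "Suc i < length P")
        case True
        then show ?thesis using P(5) by (simp add: nth_append)
      next
        case False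
        then have "i = length P - 1" "i < length P" using that P(1) by auto
        then show ?thesis using False step(2) P(1,4)
          by (auto simp: nth_append last_conv_nth)
      qed
    qed
  qed
qed

section \<open>Cycles through a critical edge\<close>

lemma proper_colouring_mono:
  assumes "proper_colouring G m c" "m \<le> n"
  shows "proper_colouring G n c"
  using assms unfolding proper_colouring_def by fastforce

text \<open>The case of the cyclic order 0, 1, ..., k - 1 with \<open>x\<close> coloured 0; other
  orders reduce to it by renaming colours.\<close>

lemma periodic_path:
  fixes V :: "'a set"
  assumes fsg: "finite_simple_graph (V, E)"
    and xy: "{x, y} \<in> E"
    and h: "proper_colouring (V, E - {{x, y}}) k h"
    and no: "\<nexists>c. proper_colouring (V, E) k c"
    and hx: "h x = 0" and k: "k \<ge> 2"
  shows "\<exists>P. distinct P \<and> k < length P \<and> set P \<subseteq> V \<and> hd P = x \<and> last P = y \<and>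
    (\<forall>i. Suc i < length P \<longrightarrow> {P ! i, P ! Suc i} \<in> E) \<and>
    (\<forall>i < length P. h (P ! i) = i mod k) \<and> length P mod k = 1"
proof -
  define r where "r = {(u, w). {u, w} \<in> E - {{x, y}} \<and> h w = Suc (h u) mod k}"
  define R where "R = {w. (x, w) \<in> r\<^sup>*}"
  have V: "u \<in> V \<and> w \<in> V \<and> u \<noteq> w" if "{u, w} \<in> E" for u w
    using fsg that unfolding finite_simple_graph_def by (fastforce simp: card_2_iff)
  have hk: "h u < k" if "u \<in> V" for u using h that by (auto simp: proper_colouring_def)
  have hne: "h u \<noteq> h w" if "{u, w} \<in> E - {{x, y}}" for u w
    using h that by (auto simp: proper_colouring_def)
  have hxy: "h y = h x"
  proof (rule ccontr)
    assume a: "h y \<noteq> h x"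
    have "h u \<noteq> h w" if "{u, w} \<in> E" for u w
      using hne[of u w] that a by (cases "{u, w} = {x, y}") (auto simp: doubleton_eq_iff)
    then have "proper_colouring (V, E) k h" using hk by (auto simp: proper_colouring_def)
    then show False using no by blast
  qed
  have "y \<in> R"
  proof (rule ccontr)
    assume y: "y \<notin> R"
    have x: "x \<in> R" by (simp add: R_def)
    \<comment> \<open>Colours advance by one on \<open>R\<close>. An edge other than
      \<open>xy\<close> leaving \<open>R\<close> cannot become monochromatic, since its outer end
      would then have been reachable; \<open>x\<close> and \<open>y\<close> separate because only
      \<open>x\<close> moves and k \<ge> 2.\<close>
    define g where "g u = (if u \<in> R then Suc (h u) mod k else h u)" for u
    have step: "w \<in> R" if "u \<in> R" "{u, w} \<in> E - {{x, y}}" "h w = Suc (h u) mod k" for u w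
      using that unfolding R_def r_def by (auto intro: rtrancl_into_rtrancl)
    have "g u \<noteq> g w" if e: "{u, w} \<in> E" for u w
    proof (cases "{u, w} = {x, y}")
      case True
      have "g x \<noteq> g y" using x y hxy hx k by (auto simp: g_def)
      then show ?thesis using True by (auto simp: doubleton_eq_iff)
    next
      case False
      then have e': "{u, w} \<in> E - {{x, y}}" "{w, u} \<in> E - {{x, y}}"
        using e by (auto simp: insert_commute)
      have "h u < k" "h w < k" "h u \<noteq> h w" using V[OF e] hk hne[OF e'(1)] by auto
      then show ?thesis
        using step[OF _ e'(1)] step[OF _ e'(2)]
        by (auto simp: g_def elim!: Suc_mod_cases[of "h u" k] Suc_mod_cases[of "h w" k])
    qed
    moreover have "g u < k" if "u \<in> V" for u using hk[OF that] k by (auto simp: g_def)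
    ultimately have "proper_colouring (V, E) k g" by (auto simp: proper_colouring_def)
    then show False using no by blast
  qed
  then obtain P where P: "P \<noteq> []" "distinct P" "hd P = x" "last P = y"
    "\<And>i. Suc i < length P \<Longrightarrow> (P ! i, P ! Suc i) \<in> r"
    using rtrancl_distinct_path[of x y r] unfolding R_def by blast
  have per: "i < length P \<Longrightarrow> h (P ! i) = i mod k" for i
  proof (induction i)
    case 0
    then show ?case using P hx by (simp add: hd_conv_nth)
  next
    case (Suc i)
    then show ?case using P(5)[of i] by (auto simp: r_def mod_Suc_eq)
  qed
  have "x \<noteq> y" using V[OF xy] by auto
  then have l2: "length P \<noteq> 1" using P(1,3,4) by (auto simp: length_Suc_conv)
  \<comment> \<open>Position and colour agree modulo k, and \<open>y\<close>, at the last position,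
    has colour 0 like \<open>x\<close>; so the number of edges of the path is a multiple of
    k.\<close>
  have l0: "(length P - 1) mod k = 0"
    using per[of "length P - 1"] P hxy hx by (simp add: last_conv_nth)
  have "length P > 1" using l2 P(1) by (cases P) auto
  then have "k < length P" using l0 by (metis One_nat_def mod_less not_less_eq
        Suc_pred' less_imp_diff_less less_trans zero_less_diff neq0_conv zero_less_one)
  moreover have "length P mod k = 1"
  proof -
    have "length P mod k = Suc ((length P - 1) mod k) mod k"
      using P(1) by (simp add: mod_Suc_eq)
    then show ?thesis using l0 k by simp
  qed
  moreover have "set P \<subseteq> V"
  proof
    fix v assume "v \<in> set P"
    then obtain i where i: "i < length P" "v = P ! i" by (auto simp: in_set_conv_nth)
    show "v \<in> V"
    proof (cases i)
      case 0
      then show ?thesis using i P V[OF xy] by (simp add: hd_conv_nth)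
    next
      case (Suc j)
      then show ?thesis using i P(5)[of j] V unfolding r_def by auto
    qed
  qed
  moreover have "\<forall>i. Suc i < length P \<longrightarrow> {P ! i, P ! Suc i} \<in> E"
    using P(5) unfolding r_def by auto
  ultimately show ?thesis using P per by blast
qed

section \<open>Cyclic colour orders and the cycles they produce\<close>

definition edge_cycles :: "nat \<Rightarrow> 'a ugraph \<Rightarrow> 'a set \<Rightarrow> 'a ugraph set" where
  "edge_cycles k G e = {C \<in> cycles_cong_one k G. e \<in> edges C}"

text \<open>\<open>length P\<close> counts vertices, so the residue 1 means a multiple of k edges;
  it is also the length of the cycle obtained by adding the edge \<open>xy\<close>.\<close>

definition colour_path ::
  "'a ugraph \<Rightarrow> nat \<Rightarrow> 'a \<Rightarrow> 'a \<Rightarrow> ('a \<Rightarrow> nat) \<Rightarrow> nat list \<Rightarrow> 'a list \<Rightarrow> bool" where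
  "colour_path G k x y f L P \<longleftrightarrow>
     distinct P \<and> k < length P \<and> set P \<subseteq> verts G \<and> hd P = x \<and> last P = y \<and>
     (\<forall>i. Suc i < length P \<longrightarrow> {P ! i, P ! Suc i} \<in> edges G) \<and>
     (\<forall>i < length P. f (P ! i) = L ! (i mod k)) \<and> length P mod k = 1"

text \<open>A cyclic order of the colours is encoded by its list starting at the colour \<open>a\<close>.\<close>

definition colour_orders :: "nat \<Rightarrow> nat \<Rightarrow> nat list set" where
  "colour_orders k a = {L \<in> permutations_of_set {..<k}. hd L = a}"

lemma colour_orders_props:
  assumes "L \<in> colour_orders k a"
  shows "distinct L" "set L = {..<k}" "length L = k" "hd L = a"
  using assms distinct_card[of L] by (auto simp: colour_orders_def permutations_of_set_def)

text \<open>With the first entry fixed, the tail is an arbitrary arrangement of the other k - 1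
  colours.\<close>

lemma card_colour_orders:
  assumes "a < k"
  shows "card (colour_orders k a) = fact (k - 1)"
proof -
  have "colour_orders k a = (#) a ` permutations_of_set ({..<k} - {a})"
  proof (intro equalityI subsetI)
    fix L assume L: "L \<in> colour_orders k a"
    note p = colour_orders_props[OF L]
    from p(3) assms obtain b M where "L = b # M" by (cases L) auto
    with p(1,4) have M: "L = a # M" "distinct M" "a \<notin> set M" by auto
    then have "set M = {..<k} - {a}" using p(2) by (simp flip: p(2))
    with M have "L = a # M" "M \<in> permutations_of_set ({..<k} - {a})"
      by (simp_all add: permutations_of_set_def)
    then show "L \<in> (#) a ` permutations_of_set ({..<k} - {a})" by blast
  next
    fix L assume "L \<in> (#) a ` permutations_of_set ({..<k} - {a})"
    then obtain M where M: "L = a # M" "set M = {..<k} - {a}" "distinct M"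
      unfolding permutations_of_set_def by blast
    then have "set L = {..<k}" using assms by (simp only: list.set insert_Diff lessThan_iff)
    then show "L \<in> colour_orders k a"
      using M by (simp add: colour_orders_def permutations_of_set_def)
  qed
  then show ?thesis using assms by (simp add: card_image)
qed

text \<open>Replacing each colour by its position in \<open>L\<close> turns the order
  \<open>L\<close> into 0, 1, ..., k - 1 and the colour of \<open>x\<close> into 0, so
  \<open>periodic_path\<close> applies.\<close>

lemma colour_path_exists:
  fixes V :: "'a set"
  assumes fsg: "finite_simple_graph (V, E)"
    and xy: "{x, y} \<in> E"
    and f: "proper_colouring (V, E - {{x, y}}) k f"
    and no: "\<nexists>c. proper_colouring (V, E) k c"
    and k: "k \<ge> 2" and L: "L \<in> colour_orders k (f x)"
  shows "\<exists>P. colour_path (V, E) k x y f L P"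
proof -
  note p = colour_orders_props[OF L]
  have inj: "inj_on ((!) L) {..<k}" using p by (simp add: inj_on_nth)
  have im: "(!) L ` {..<k} = {..<k}" using p(2,3) nth_image[of k L] by (simp add: atLeast0LessThan)
  define h where "h = inv_into {..<k} ((!) L) \<circ> f"
  have fV: "f v < k" if "v \<in> V" for v using f that by (auto simp: proper_colouring_def)
  have V: "u \<in> V \<and> w \<in> V" if "{u, w} \<in> E" for u w
    using fsg that unfolding finite_simple_graph_def by fastforce
  have hf: "L ! h v = f v" "h v < k" if "v \<in> V" for v
    using fV[OF that] im f_inv_into_f[of "f v" "(!) L" "{..<k}"]
      inv_into_into[of "f v" "(!) L" "{..<k}"]
    by (auto simp: h_def)
  have "x \<in> V" using V[OF xy] by simp
  have h: "proper_colouring (V, E - {{x, y}}) k h"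
    unfolding proper_colouring_def
  proof (intro conjI ballI allI impI)
    show "h v < k" if "v \<in> verts (V, E - {{x, y}})" for v using that hf by simp
    fix u w assume e: "{u, w} \<in> edges (V, E - {{x, y}})"
    then have "f u \<noteq> f w" using f by (auto simp: proper_colouring_def)
    then moreover have "u \<in> V" "w \<in> V" using V e by auto
    ultimately show "h u \<noteq> h w" using hf(1) by metis
  qed
  have "L ! 0 = f x" using p k by (metis hd_conv_nth list.size(3) not_numeral_le_zero)
  then have "L ! h x = L ! 0" using hf(1)[OF \<open>x \<in> V\<close>] by simp
  then have hx: "h x = 0" using inj hf(2)[OF \<open>x \<in> V\<close>] k by (auto dest: inj_onD)
  from periodic_path[OF fsg xy h no hx k] obtain P where
    P: "distinct P" "k < length P" "set P \<subseteq> V" "hd P = x" "last P = y"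
      "\<forall>i. Suc i < length P \<longrightarrow> {P ! i, P ! Suc i} \<in> E"
      "\<forall>i < length P. h (P ! i) = i mod k" "length P mod k = 1"
    by blast
  have "f (P ! i) = L ! (i mod k)" if "i < length P" for i
    using that P(3,7) hf(1)[of "P ! i"] by (metis nth_mem subsetD)
  then show ?thesis using P unfolding colour_path_def by auto
qed

text \<open>The wrap-around edge of the cyclic sequence, from its last vertex \<open>y\<close> to
  its first vertex \<open>x\<close>, is the edge \<open>xy\<close> itself.\<close>

lemma cycle_graph_colour_path:
  assumes fsg: "finite_simple_graph G" and xy: "{x, y} \<in> edges G"
    and k: "k \<ge> 2" and P: "colour_path G k x y f L P"
  shows "cycle_graph P \<in> edge_cycles k G {x, y}"
proof -
  have p: "distinct P" "3 \<le> length P" "set P \<subseteq> verts G" "hd P = x" "last P = y"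
    "\<And>i. Suc i < length P \<Longrightarrow> {P ! i, P ! Suc i} \<in> edges G" "length P mod k = 1"
    using P k by (auto simp: colour_path_def)
  have ne: "P \<noteq> []" using p(2) by auto
  have sub: "edges (cycle_graph P) \<subseteq> edges G"
  proof
    fix e assume "e \<in> edges (cycle_graph P)"
    then obtain i where i: "i < length P" "e = {P ! i, P ! (Suc i mod length P)}"
      unfolding edges_cycle_graph by auto
    from i(1) show "e \<in> edges G"
    proof (cases rule: Suc_mod_cases)
      case 1
      then show ?thesis using i(2) p(6) by simp
    next
      case 2
      then show ?thesis
        using i(2) p(4,5) xy ne by (simp add: hd_conv_nth last_conv_nth insert_commute)
    qed
  qed
  have le: "{x, y} \<in> edges (cycle_graph P)"
  proof -
    have "{P ! (length P - 1), P ! (Suc (length P - 1) mod length P)} = {x, y}"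
      using p(4,5) ne by (simp add: hd_conv_nth last_conv_nth insert_commute)
    moreover have "length P - 1 < length P" using ne by simp
    ultimately show ?thesis unfolding edges_cycle_graph by blast
  qed
  have "e \<subseteq> set P" if "e \<in> edges (cycle_graph P)" for e
    using that Suc_mod_less[of _ "length P"] unfolding edges_cycle_graph by fastforce
  then have "finite_simple_graph (cycle_graph P)"
    using sub fsg unfolding finite_simple_graph_def verts_cycle_graph by blast
  then have "subgraph_of (cycle_graph P) G"
    using sub p(3) by (simp add: subgraph_of_def verts_cycle_graph)
  moreover have "[cycle_length (cycle_graph P) = 1] (mod k)"
    using p k by (simp add: cycle_length_cycle_graph cong_def)
  moreover have "is_cycle (cycle_graph P)" using p(1,2) unfolding is_cycle_def by blast
  ultimately show ?thesis using le by (simp add: edge_cycles_def cycles_cong_one_def)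
qed

lemma finite_cycles_cong_one:
  assumes "finite_simple_graph G"
  shows "finite (cycles_cong_one k G)"
proof (rule finite_subset)
  show "cycles_cong_one k G \<subseteq> Pow (verts G) \<times> Pow (edges G)"
    by (auto simp: cycles_cong_one_def subgraph_of_def)
  have "edges G \<subseteq> Pow (verts G)" using assms by (auto simp: finite_simple_graph_def)
  then show "finite (Pow (verts G) \<times> Pow (edges G))"
    using assms by (auto simp: finite_simple_graph_def intro: finite_subset)
qed

text \<open>One chosen path per colour order gives an injection into the cycles through
  \<open>xy\<close>: the cycle determines the path, and the colours of its first k vertices spell
  the order. If the count is exact, the injection is onto, so every cycle through \<open>xy\<close>
  is coloured periodically, whichever colouring \<open>f\<close> was taken.\<close>

lemma edge_cycles_colour_paths:
  fixes V :: "'a set"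
  assumes fsg: "finite_simple_graph (V, E)"
    and xy: "{x, y} \<in> E"
    and f: "proper_colouring (V, E - {{x, y}}) k f"
    and no: "\<nexists>c. proper_colouring (V, E) k c"
    and k: "k \<ge> 2"
  shows "fact (k - 1) \<le> card (edge_cycles k (V, E) {x, y})"
    and "card (edge_cycles k (V, E) {x, y}) = fact (k - 1) \<Longrightarrow>
      C \<in> edge_cycles k (V, E) {x, y} \<Longrightarrow>
      \<exists>L P. L \<in> colour_orders k (f x) \<and> colour_path (V, E) k x y f L P \<and> C = cycle_graph P"
proof -
  have fin: "finite (edge_cycles k (V, E) {x, y})"
    using finite_cycles_cong_one[OF fsg] by (simp add: edge_cycles_def)
  define p where "p L = (SOME P. colour_path (V, E) k x y f L P)" for L
  have p: "colour_path (V, E) k x y f L (p L)" if "L \<in> colour_orders k (f x)" for L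
    using colour_path_exists[OF fsg xy f no k that] unfolding p_def by (rule someI_ex)
  have im: "cycle_graph ` p ` colour_orders k (f x) \<subseteq> edge_cycles k (V, E) {x, y}"
    using cycle_graph_colour_path[OF fsg _ k p] xy by auto
  have "inj_on (cycle_graph \<circ> p) (colour_orders k (f x))"
  proof (rule inj_onI)
    fix L M assume LM: "L \<in> colour_orders k (f x)" "M \<in> colour_orders k (f x)"
      and eq: "(cycle_graph \<circ> p) L = (cycle_graph \<circ> p) M"
    note pL = p[OF LM(1), unfolded colour_path_def] and pM = p[OF LM(2), unfolded colour_path_def]
    have "p L = p M" by (rule cycle_graph_inj) (use pL pM eq k in auto)
    then have "L ! i = M ! i" if "i < k" for i using pL pM that
      by (metis less_trans mod_less)
    then show "L = M" using colour_orders_props(3) LM by (metis nth_equalityI)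
  qed
  then have "card (cycle_graph ` p ` colour_orders k (f x)) = card (colour_orders k (f x))"
    by (simp only: card_image image_comp)
  moreover have "f x < k"
    using f fsg xy by (auto simp: proper_colouring_def finite_simple_graph_def)
  ultimately have c: "card (cycle_graph ` p ` colour_orders k (f x)) = fact (k - 1)"
    by (simp add: card_colour_orders)
  show "fact (k - 1) \<le> card (edge_cycles k (V, E) {x, y})"
    using card_mono[OF fin im] c by simp
  show "\<exists>L P. L \<in> colour_orders k (f x) \<and> colour_path (V, E) k x y f L P \<and> C = cycle_graph P"
    if "card (edge_cycles k (V, E) {x, y}) = fact (k - 1)" "C \<in> edge_cycles k (V, E) {x, y}"
  proof -
    from that have "C \<in> cycle_graph ` p ` colour_orders k (f x)"
      using card_subset_eq[OF fin im] c by simp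
    then show ?thesis using p by blast
  qed
qed

text \<open>By exactness \<open>C\<close> comes from a colour path for \<open>f\<close> and from one
  for \<open>g\<close>. Both run from \<open>x\<close> to \<open>y\<close>, hence are the same list,
  and in either colouring two vertices share a colour exactly when their positions agree modulo
  k.\<close>

lemma colouring_unique_on_cycle:
  fixes V :: "'a set"
  assumes fsg: "finite_simple_graph (V, E)"
    and xy: "{x, y} \<in> E"
    and f: "proper_colouring (V, E - {{x, y}}) k f"
    and g: "proper_colouring (V, E - {{x, y}}) k g"
    and no: "\<nexists>c. proper_colouring (V, E) k c"
    and k: "k \<ge> 2"
    and card: "card (edge_cycles k (V, E) {x, y}) = fact (k - 1)"
    and C: "C \<in> edge_cycles k (V, E) {x, y}"
    and uv: "u \<in> verts C" "v \<in> verts C"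
  shows "f u = f v \<longleftrightarrow> g u = g v"
proof -
  from edge_cycles_colour_paths(2)[OF fsg xy f no k card C] obtain L P where
    L: "L \<in> colour_orders k (f x)" and P: "colour_path (V, E) k x y f L P" "C = cycle_graph P"
    by blast
  from edge_cycles_colour_paths(2)[OF fsg xy g no k card C] obtain M Q where
    M: "M \<in> colour_orders k (g x)" and Q: "colour_path (V, E) k x y g M Q" "C = cycle_graph Q"
    by blast
  have PQ: "P = Q" by (rule cycle_graph_inj) (use P Q k in \<open>auto simp: colour_path_def\<close>)
  from uv P(2) obtain i j where ij: "i < length P" "u = P ! i" "j < length P" "v = P ! j"
    by (auto simp: verts_cycle_graph in_set_conv_nth)
  have "f u = f v \<longleftrightarrow> i mod k = j mod k"
    using ij P(1) colour_orders_props[OF L] k by (auto simp: colour_path_def nth_eq_iff_index_eq)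
  moreover have "g u = g v \<longleftrightarrow> i mod k = j mod k"
    using ij Q(1) PQ colour_orders_props[OF M] k
    by (auto simp: colour_path_def nth_eq_iff_index_eq)
  ultimately show ?thesis by simp
qed

section \<open>Uniquely colourable graphs\<close>

text \<open>The spanning-tree bound, with connectivity phrased as every cut being crossed. A vertex
  set grows from \<open>r\<close> along crossing edges, each new vertex bringing a new inner
  edge.\<close>

lemma card_le_edges_if_connected:
  fixes V :: "'a set"
  assumes fin: "finite V" "finite E"
    and cut: "\<And>S. S \<subseteq> V \<Longrightarrow> S \<noteq> {} \<Longrightarrow> S \<noteq> V \<Longrightarrow>
      \<exists>a b. a \<in> S \<and> b \<in> V - S \<and> {a, b} \<in> E"
  shows "card V \<le> card E + 1"
proof (cases "V = {}")
  case False
  then obtain r where r: "r \<in> V" by blast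
  have "\<exists>S \<subseteq> V. card S = Suc j \<and> j \<le> card {e \<in> E. e \<subseteq> S}" if "j < card V" for j
    using that
  proof (induction j)
    case 0
    then show ?case using r by (intro exI[of _ "{r}"]) auto
  next
    case (Suc j)
    then obtain S where S: "S \<subseteq> V" "card S = Suc j" "j \<le> card {e \<in> E. e \<subseteq> S}" by auto
    then have "S \<noteq> {}" "S \<noteq> V" using Suc.prems by auto
    then obtain a b where ab: "a \<in> S" "b \<in> V - S" "{a, b} \<in> E" using cut[OF S(1)] by blast
    \<comment> \<open>The crossing edge is not yet counted, because \<open>b\<close> lies outside
      \<open>S\<close>.\<close>
    have "Suc j \<le> card (insert {a, b} {e \<in> E. e \<subseteq> S})" using S(3) ab(2) fin by simp
    also have "\<dots> \<le> card {e \<in> E. e \<subseteq> insert b S}"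
      using fin ab by (intro card_mono) auto
    finally have "Suc j \<le> card {e \<in> E. e \<subseteq> insert b S}" .
    moreover have "card (insert b S) = Suc (Suc j)"
      using S ab fin by (simp add: finite_subset)
    ultimately show ?case using S(1) ab(2) by (intro exI[of _ "insert b S"]) auto
  qed
  from this[of "card V - 1"] obtain S where "card V - 1 \<le> card {e \<in> E. e \<subseteq> S}"
    using False fin by (auto simp: card_gt_0_iff)
  also have "\<dots> \<le> card E" using fin by (intro card_mono) auto
  finally show ?thesis by simp
qed simp

text \<open>Kempe change: if the subgraph on colours i and j were disconnected, swapping the two
  colours on a union \<open>S\<close> of components would give a colouring with different
  classes.\<close>

lemma two_colour_classes_connected:
  fixes V :: "'a set"
  assumes fsg: "finite_simple_graph (V, E)"
    and f: "proper_colouring (V, E) k f"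
    and uniq: "\<And>g u v. proper_colouring (V, E) k g \<Longrightarrow> u \<in> V \<Longrightarrow> v \<in> V \<Longrightarrow>
      f u = f v \<longleftrightarrow> g u = g v"
    and ij: "i < k" "j < k" "i \<noteq> j"
  shows "card {v \<in> V. f v \<in> {i, j}} \<le> card {e \<in> E. f ` e = {i, j}} + 1"
proof (rule card_le_edges_if_connected)
  have V: "u \<in> V \<and> w \<in> V" if "{u, w} \<in> E" for u w
    using fsg that unfolding finite_simple_graph_def by fastforce
  have fV: "f v < k" if "v \<in> V" for v using f that by (auto simp: proper_colouring_def)
  have fne: "f u \<noteq> f w" if "{u, w} \<in> E" for u w
    using f that by (auto simp: proper_colouring_def)
  show "finite {v \<in> V. f v \<in> {i, j}}" using fsg by (simp add: finite_simple_graph_def)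
  have "finite E"
    using fsg by (auto simp: finite_simple_graph_def intro: finite_subset[of E "Pow V"])
  then show "finite {e \<in> E. f ` e = {i, j}}" by simp
  fix S assume S: "S \<subseteq> {v \<in> V. f v \<in> {i, j}}" "S \<noteq> {}" "S \<noteq> {v \<in> V. f v \<in> {i, j}}"
  show "\<exists>a b. a \<in> S \<and> b \<in> {v \<in> V. f v \<in> {i, j}} - S \<and> {a, b} \<in> {e \<in> E. f ` e = {i, j}}"
  proof (rule ccontr)
    assume con: "\<not> ?thesis"
    have closed: "b \<in> S" if "a \<in> S" "{a, b} \<in> E" "f b \<in> {i, j}" for a b
    proof -
      have "f a \<in> {i, j}" "f a \<noteq> f b" "b \<in> V" using that S(1) fne V by auto
      then have "f ` {a, b} = {i, j}" using that(3) by auto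
      then show ?thesis using con that \<open>b \<in> V\<close> by blast
    qed
    define g where "g v = (if v \<in> S then (if f v = i then j else i) else f v)" for v
    have "g u \<noteq> g w" if e: "{u, w} \<in> E" for u w
    proof -
      have e': "{w, u} \<in> E" using e by (simp add: insert_commute)
      have "f u \<in> {i, j}" if "u \<in> S" using that S(1) by auto
      moreover have "f w \<in> {i, j}" if "w \<in> S" using that S(1) by auto
      ultimately show ?thesis
        using fne[OF e] closed[OF _ e] closed[OF _ e'] by (auto simp: g_def)
    qed
    moreover have "g v < k" if "v \<in> V" for v using fV[OF that] ij by (simp add: g_def)
    ultimately have g: "proper_colouring (V, E) k g" by (auto simp: proper_colouring_def)
    obtain u where u: "u \<in> S" using S(2) by blast
    obtain v where v: "v \<in> V" "f v \<in> {i, j}" "v \<notin> S" using S(1,3) by blast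
    have "u \<in> V" "f u \<in> {i, j}" using u S(1) by auto
    \<comment> \<open>Only \<open>u\<close> changes colour, and both vertices are coloured from {i,
      j}, so the swap reverses whether \<open>u\<close> and \<open>v\<close> agree.\<close>
    then show False
      using uniq[OF g \<open>u \<in> V\<close> v(1)] u v(2,3) ij(3)
      by (cases "f u = i"; cases "f v = i") (simp_all add: g_def)
  qed
qed

text \<open>Sum \<open>two_colour_classes_connected\<close> over all pairs of colours. A vertex is
  counted for the k - 1 pairs containing its colour, an edge for the single pair of its end colours,
  and the summands 1 add up to \<open>k choose 2\<close>.\<close>

lemma uniquely_colourable_edges:
  fixes V :: "'a set"
  assumes fsg: "finite_simple_graph (V, E)"
    and f: "proper_colouring (V, E) k f"
    and uniq: "\<And>g u v. proper_colouring (V, E) k g \<Longrightarrow> u \<in> V \<Longrightarrow> v \<in> V \<Longrightarrow>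
      f u = f v \<longleftrightarrow> g u = g v"
  shows "(k - 1) * card V \<le> card E + (k choose 2)"
proof -
  define T where "T = {t. t \<subseteq> {..<k} \<and> card t = 2}"
  have finT: "finite T" unfolding T_def by simp
  have finV: "finite V" using fsg by (simp add: finite_simple_graph_def)
  have finE: "finite E"
    using fsg by (auto simp: finite_simple_graph_def intro: finite_subset[of E "Pow V"])
  have cardT: "card T = k choose 2" unfolding T_def by (simp add: n_subsets)
  have deg: "card {t \<in> T. f v \<in> t} = k - 1" if "v \<in> V" for v
  proof -
    have fv: "f v < k" using f that by (auto simp: proper_colouring_def)
    have "{t \<in> T. f v \<in> t} = (\<lambda>c. {f v, c}) ` ({..<k} - {f v})"
      using fv by (auto simp: T_def card_2_iff image_iff doubleton_eq_iff)
    moreover have "inj_on (\<lambda>c. {f v, c}) ({..<k} - {f v})"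
      by (auto simp: inj_on_def doubleton_eq_iff)
    ultimately show ?thesis using fv by (simp add: card_image)
  qed
  have fE: "f ` e \<in> T" if "e \<in> E" for e
  proof -
    from fsg that have e: "e \<subseteq> V" "card e = 2" by (auto simp: finite_simple_graph_def)
    then obtain a b where "e = {a, b}" by (auto simp: card_2_iff)
    then show ?thesis using f e that by (auto simp: T_def proper_colouring_def card_insert_if)
  qed
  have "(k - 1) * card V = (\<Sum>t\<in>T. card {v \<in> V. f v \<in> t})"
    using sum_multicount[OF finT finV, of "\<lambda>t v. f v \<in> t" "k - 1"] deg by simp
  also have "\<dots> \<le> (\<Sum>t\<in>T. card {e \<in> E. f ` e = t} + 1)"
  proof (rule sum_mono)
    fix t assume "t \<in> T"
    then obtain i j where "t = {i, j}" "i \<noteq> j" "i < k" "j < k"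
      by (auto simp: T_def card_2_iff)
    then show "card {v \<in> V. f v \<in> t} \<le> card {e \<in> E. f ` e = t} + 1"
      using two_colour_classes_connected[OF fsg f uniq] by simp
  qed
  also have "\<dots> = card E + (k choose 2)"
  proof -
    have "(\<Sum>t\<in>T. card {e \<in> E. f ` e = t}) = 1 * card E"
    proof (rule sum_multicount[OF finT finE], rule ballI)
      fix e assume "e \<in> E"
      then have "{t \<in> T. f ` e = t} = {f ` e}" using fE by auto
      then show "card {t \<in> T. f ` e = t} = 1" by simp
    qed
    then show ?thesis using cardT by (simp only: sum.distrib) simp
  qed
  finally show ?thesis .
qed

section \<open>Critical graphs\<close>

lemma critical_graph_colouring:
  assumes crit: "critical_graph (k + 1) G"
  shows "\<nexists>c. proper_colouring G k c"
    and "subgraph_of H G \<Longrightarrow> H \<noteq> G \<Longrightarrow> \<exists>c. proper_colouring H k c"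
proof -
  have chi: "chromatic_number G = k + 1" using crit by (simp add: critical_graph_def)
  show "\<nexists>c. proper_colouring G k c"
  proof
    assume "\<exists>c. proper_colouring G k c"
    then have "chromatic_number G \<le> k" unfolding chromatic_number_def by (rule Least_le)
    then show False using chi by simp
  qed
  assume H: "subgraph_of H G" "H \<noteq> G"
  then have le: "chromatic_number H \<le> k" using crit unfolding critical_graph_def
    by (metis Suc_eq_plus1 less_Suc_eq_le)
  have fsg: "finite_simple_graph H" using H by (simp add: subgraph_of_def)
  \<comment> \<open>An injective colouring. Since \<open>chromatic_number\<close> is a
    \<open>LEAST\<close>, it yields a colouring only once some number of colours is known to
    suffice.\<close>
  then obtain c n where c: "c ` verts H = {i. i < (n::nat)}" "inj_on c (verts H)"
    using finite_imp_inj_to_nat_seg[of "verts H"] by (auto simp: finite_simple_graph_def)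
  have "proper_colouring H n c"
    unfolding proper_colouring_def
  proof (intro conjI ballI allI impI)
    show "c v < n" if "v \<in> verts H" for v using c(1) that by blast
    fix u v assume e: "{u, v} \<in> edges H"
    then have "{u, v} \<subseteq> verts H" "card {u, v} = 2"
      using fsg unfolding finite_simple_graph_def by blast+
    then have "u \<in> verts H" "v \<in> verts H" "u \<noteq> v" by auto
    then show "c u \<noteq> c v" using c(2) by (auto dest: inj_onD)
  qed
  then have "\<exists>n c. proper_colouring H n c" by blast
  then have "\<exists>c. proper_colouring H (chromatic_number H) c"
    unfolding chromatic_number_def by (rule LeastI_ex)
  then show "\<exists>c. proper_colouring H k c" using le proper_colouring_mono by blast
qed

text \<open>In a k-colouring of the graph with \<open>v\<close> deleted every colour occurs on a
  neighbour of \<open>v\<close>, since a missing one could be given to \<open>v\<close>. Neighbours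
  of different colours give different edges.\<close>

lemma critical_graph_degree:
  assumes crit: "critical_graph (k + 1) (V, E)" and v: "v \<in> V"
  shows "k \<le> card {e \<in> E. v \<in> e}"
proof -
  have fsg: "finite_simple_graph (V, E)" using crit by (simp add: critical_graph_def)
  have finE: "finite E"
    using fsg by (auto simp: finite_simple_graph_def intro: finite_subset[of E "Pow V"])
  have V: "u \<in> V \<and> w \<in> V \<and> u \<noteq> w" if "{u, w} \<in> E" for u w
    using fsg that unfolding finite_simple_graph_def by (fastforce simp: card_2_iff)
  let ?H = "(V - {v}, {e \<in> E. v \<notin> e})"
  have "subgraph_of ?H (V, E)" "?H \<noteq> (V, E)"
    using fsg v by (auto simp: subgraph_of_def finite_simple_graph_def)
  then obtain c where c: "proper_colouring ?H k c"
    using critical_graph_colouring(2)[OF crit] by blast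
  have "\<exists>w. {v, w} \<in> E \<and> c w = a" if a: "a < k" for a
  proof (rule ccontr)
    assume con: "\<not> ?thesis"
    have "(c(v := a)) u \<noteq> (c(v := a)) w" if e: "{u, w} \<in> E" for u w
    proof -
      have "{w, u} \<in> E" using e by (simp add: insert_commute)
      then show ?thesis using con c e V[OF e] by (auto simp: proper_colouring_def)
    qed
    then have "proper_colouring (V, E) k (c(v := a))"
      using c a by (auto simp: proper_colouring_def)
    then show False using critical_graph_colouring(1)[OF crit] by blast
  qed
  then obtain w where w: "\<And>a. a < k \<Longrightarrow> {v, w a} \<in> E \<and> c (w a) = a" by metis
  have "inj_on (\<lambda>a. {v, w a}) {..<k}"
    by (rule inj_onI) (metis w lessThan_iff doubleton_eq_iff)
  then have "k = card ((\<lambda>a. {v, w a}) ` {..<k})" by (simp add: card_image)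
  also have "\<dots> \<le> card {e \<in> E. v \<in> e}" using w finE by (intro card_mono) auto
  finally show ?thesis .
qed

section \<open>Counting cycles at a vertex, and the case of equality\<close>

theorem theorem3:
  fixes G :: "'a ugraph" and k :: nat
  assumes "k \<ge> 3" and "critical_graph (k + 1) G"
  shows "real (card (cycles_cong_one k G)) \<ge> fact k / 2
    \<and> (real (card (cycles_cong_one k G)) = fact k / 2 \<longrightarrow> is_complete_graph (k + 1) G)"
proof -
  obtain V E where G: "G = (V, E)" by (cases G)
  note k = assms(1) and crit = assms(2)[unfolded G]
  have k2: "k \<ge> 2" using k by simp
  have fsg: "finite_simple_graph (V, E)" using crit by (simp add: critical_graph_def)
  have finV: "finite V" using fsg by (simp add: finite_simple_graph_def)
  have finE: "finite E"
    using fsg by (auto simp: finite_simple_graph_def intro: finite_subset[of E "Pow V"])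
  have no: "\<nexists>c. proper_colouring (V, E) k c" by (rule critical_graph_colouring(1)[OF crit])
  let ?Cyc = "cycles_cong_one k (V, E)"
  have finC: "finite ?Cyc" by (rule finite_cycles_cong_one[OF fsg])
  have col: "\<exists>f. proper_colouring (V, E - {{x, y}}) k f" if "{x, y} \<in> E" for x y
    using critical_graph_colouring(2)[OF crit, of "(V, E - {{x, y}})"] fsg that
    by (auto simp: subgraph_of_def finite_simple_graph_def)
  have edge: "fact (k - 1) \<le> card (edge_cycles k (V, E) e)" if "e \<in> E" for e
  proof -
    have "card e = 2" using fsg that by (auto simp: finite_simple_graph_def)
    then obtain x y where "e = {x, y}" by (auto simp: card_2_iff)
    then show ?thesis using col[of x y] edge_cycles_colour_paths(1)[OF fsg _ _ no k2] that by blast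
  qed
  have inc: "card {e \<in> E. e \<in> edges C \<and> v \<in> e} \<le> 2" if "C \<in> ?Cyc" for C v
  proof -
    have "is_cycle C" "edges C \<subseteq> E" using that by (auto simp: cycles_cong_one_def subgraph_of_def)
    then have "{e \<in> E. e \<in> edges C \<and> v \<in> e} = {e \<in> edges C. v \<in> e}" by auto
    then show ?thesis
      using \<open>is_cycle C\<close> card_cycle_graph_incident_le unfolding is_cycle_def by metis
  qed
  define D where "D v = {e \<in> E. v \<in> e}" for v
  have deg: "k \<le> card (D v)" if "v \<in> V" for v
    unfolding D_def by (rule critical_graph_degree[OF crit that])
  \<comment> \<open>Double counting of the pairs of an edge at \<open>v\<close> and a cycle
    containing it.\<close>
  have count: "(\<Sum>e\<in>D v. card (edge_cycles k (V, E) e))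
      = (\<Sum>C\<in>?Cyc. card {e \<in> E. e \<in> edges C \<and> v \<in> e})" for v
  proof -
    have "(\<Sum>e\<in>D v. card {C \<in> ?Cyc. e \<in> edges C}) = (\<Sum>C\<in>?Cyc. card {e \<in> D v. e \<in> edges C})"
      using finE finC by (intro sum_multicount_gen) (auto simp: D_def)
    moreover have "{e \<in> D v. e \<in> edges C} = {e \<in> E. e \<in> edges C \<and> v \<in> e}" for C
      by (auto simp: D_def)
    ultimately show ?thesis by (simp add: edge_cycles_def)
  qed
  have low: "card (D v) * fact (k - 1) \<le> (\<Sum>e\<in>D v. card (edge_cycles k (V, E) e))" for v
    using sum_bounded_below[of "D v" "fact (k - 1)" "\<lambda>e. card (edge_cycles k (V, E) e)"] edge
    by (simp add: D_def)
  have up: "(\<Sum>C\<in>?Cyc. card {e \<in> E. e \<in> edges C \<and> v \<in> e}) \<le> 2 * card ?Cyc" for v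
    using sum_bounded_above[of ?Cyc "\<lambda>C. card {e \<in> E. e \<in> edges C \<and> v \<in> e}" 2] inc by simp
  have fk: "fact k = k * (fact (k - 1) :: nat)" using k by (simp add: fact_reduce)
  have "V \<noteq> {}"
  proof
    assume "V = {}"
    then have "E = {}" using fsg by (auto simp: finite_simple_graph_def)
    with \<open>V = {}\<close> have "proper_colouring (V, E) k (\<lambda>_. 0)" by (simp add: proper_colouring_def)
    then show False using no by blast
  qed
  then obtain v0 where v0: "v0 \<in> V" by blast
  have degf: "fact k \<le> card (D v) * fact (k - 1)" if "v \<in> V" for v
    unfolding fk using deg[OF that] by simp
  \<comment> \<open>The chain is k! = k (k - 1)! \<le> deg(v0) (k - 1)! \<le> number of such pairs
    \<le> \<open>2 * card ?Cyc\<close>.\<close>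
  have main: "fact k \<le> 2 * card ?Cyc"
    using degf[OF v0] low[of v0] count[of v0] up[of v0] by linarith
  \<comment> \<open>Equality makes every estimate of this chain tight, and at every vertex: the
    graph is k-regular, each edge lies in exactly (k - 1)! of the cycles, and each cycle has two
    edges at each vertex.\<close>
  have "is_complete_graph (k + 1) (V, E)" if eq: "2 * card ?Cyc = fact k"
  proof -
    have D: "card (D v) = k" if "v \<in> V" for v
    proof -
      have "card (D v) * fact (k - 1) \<le> k * fact (k - 1)"
        using low[of v] count[of v] up[of v] eq fk by linarith
      then show ?thesis using deg[OF that] by simp
    qed
    have all: "(\<Sum>e\<in>D v. card (edge_cycles k (V, E) e)) = card (D v) * fact (k - 1)"
      "(\<Sum>C\<in>?Cyc. card {e \<in> E. e \<in> edges C \<and> v \<in> e}) = 2 * card ?Cyc" if "v \<in> V" for v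
      using degf[OF that] D[OF that] low[of v] count[of v] up[of v] eq fk by simp_all
    have ec: "card (edge_cycles k (V, E) e) = fact (k - 1)" if "v \<in> V" "e \<in> D v" for v e
    proof (rule ccontr)
      assume "card (edge_cycles k (V, E) e) \<noteq> fact (k - 1)"
      then have "fact (k - 1) < card (edge_cycles k (V, E) e)"
        using edge[of e] that by (auto simp: D_def)
      then have "(\<Sum>e\<in>D v. fact (k - 1)) < (\<Sum>e\<in>D v. card (edge_cycles k (V, E) e))"
        using edge that finE by (intro sum_strict_mono_ex1) (auto simp: D_def)
      then show False using all(1)[OF that(1)] by simp
    qed
    \<comment> \<open>A cycle missing \<open>v\<close> would contribute less than 2 to a sum that
      needs 2 from every cycle.\<close>
    have ham: "V \<subseteq> verts C" if C: "C \<in> ?Cyc" for C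
    proof
      fix v assume v: "v \<in> V"
      have "card {e \<in> E. e \<in> edges C \<and> v \<in> e} = 2"
      proof (rule ccontr)
        assume "card {e \<in> E. e \<in> edges C \<and> v \<in> e} \<noteq> 2"
        then have "card {e \<in> E. e \<in> edges C \<and> v \<in> e} < 2" using inc[OF C, of v] by simp
        then have "(\<Sum>C\<in>?Cyc. card {e \<in> E. e \<in> edges C \<and> v \<in> e}) < (\<Sum>C\<in>?Cyc. 2)"
          using inc C finC by (intro sum_strict_mono_ex1) auto
        then show False using all(2)[OF v] by simp
      qed
      then obtain e where "e \<in> edges C" "v \<in> e" by (metis (no_types, lifting) card.empty
            all_not_in_conv mem_Collect_eq zero_neq_numeral)
      then show "v \<in> verts C"
        using C by (auto simp: cycles_cong_one_def subgraph_of_def finite_simple_graph_def)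
    qed
    have "D v0 \<noteq> {}" using D[OF v0] k by auto
    then obtain e where e: "e \<in> D v0" by blast
    then have eE: "e \<in> E" by (simp add: D_def)
    then have "card e = 2" using fsg by (auto simp: finite_simple_graph_def)
    then obtain x y where xy: "e = {x, y}" by (auto simp: card_2_iff)
    have card_e: "card (edge_cycles k (V, E) {x, y}) = fact (k - 1)" using ec[OF v0 e] xy by simp
    then have "edge_cycles k (V, E) {x, y} \<noteq> {}" by (metis card.empty fact_nonzero)
    then obtain C where C: "C \<in> edge_cycles k (V, E) {x, y}" by blast
    then have VC: "V \<subseteq> verts C" using ham by (auto simp: edge_cycles_def)
    obtain f where f: "proper_colouring (V, E - {{x, y}}) k f" using col eE xy by blast
    have fsg': "finite_simple_graph (V, E - {{x, y}})"
      using fsg by (auto simp: finite_simple_graph_def)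
    \<comment> \<open>\<open>C\<close> passes through all of \<open>V\<close>, so agreement of the
      colour classes along \<open>C\<close> is unique colourability of the whole graph without
      \<open>xy\<close>.\<close>
    have "(k - 1) * card V \<le> card (E - {{x, y}}) + (k choose 2)"
    proof (rule uniquely_colourable_edges[OF fsg' f])
      show "f u = f v \<longleftrightarrow> g u = g v"
        if "proper_colouring (V, E - {{x, y}}) k g" "u \<in> V" "v \<in> V" for g u v
        by (rule colouring_unique_on_cycle[OF fsg _ f that(1) no k2 card_e C])
          (use eE xy that VC in auto)
    qed
    moreover have "card (E - {{x, y}}) + 1 = card E" using finE eE xy
      by (metis card_Suc_Diff1 Suc_eq_plus1)
    ultimately have le: "(k - 1) * card V + 1 \<le> card E + (k choose 2)" by linarith
    \<comment> \<open>Handshake identity, with all degrees equal to k.\<close>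
    have hand: "k * card V = 2 * card E"
    proof -
      have "(\<Sum>v\<in>V. card {e \<in> E. v \<in> e}) = 2 * card E"
      proof (rule sum_multicount[OF finV finE], rule ballI)
        fix e assume "e \<in> E"
        then have "{v \<in> V. v \<in> e} = e" "card e = 2" using fsg by (auto simp: finite_simple_graph_def)
        then show "card {v \<in> V. v \<in> e} = 2" by simp
      qed
      then show ?thesis using D by (simp add: D_def mult.commute)
    qed
    have n_le: "card V \<le> k + 1"
    proof -
      \<comment> \<open>With n = \<open>card V\<close>, doubling \<open>le\<close> and inserting
        \<open>hand\<close> gives (k - 2) n \<le> k(k - 1) - 2 = (k - 2)(k + 1). Writing k = m + 3
        avoids truncated subtraction and makes the cancelled factor m + 1 visibly positive.\<close>
      obtain m where m: "k = m + 3" using k by (metis add.commute le_Suc_ex)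
      have ch: "2 * (k choose 2) = k * (k - 1)"
        using k by (simp add: choose_two)
      have "2 * ((k - 1) * card V) + 2 \<le> k * card V + k * (k - 1)"
        using le hand ch by linarith
      then have "(m + 1) * card V \<le> (m + 1) * (m + 4)"
        by (simp add: m algebra_simps)
      then have "card V \<le> m + 4" by (simp only: mult_le_cancel1)
      then show ?thesis by (simp add: m)
    qed
    \<comment> \<open>All possible edges at \<open>v\<close>. As \<open>D v\<close> lies inside and
      has k elements, n \<ge> k + 1; with \<open>n_le\<close> the two sets have equal size, so every
      pair of vertices is an edge.\<close>
    define S where "S v = (\<lambda>w. {v, w}) ` (V - {v})" for v
    have cS: "card (S v) = card V - 1" if "v \<in> V" for v
    proof -
      have "inj_on (\<lambda>w. {v, w}) (V - {v})" by (auto simp: inj_on_def doubleton_eq_iff)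
      then show ?thesis using that finV by (simp add: S_def card_image)
    qed
    have DS: "D v \<subseteq> S v" if "v \<in> V" for v
    proof
      fix e assume e: "e \<in> D v"
      then have "e \<subseteq> V" "card e = 2" "v \<in> e"
        using fsg by (auto simp: D_def finite_simple_graph_def)
      then obtain w where "e = {v, w}" "w \<noteq> v" by (auto simp: card_2_iff)
      then show "e \<in> S v" using \<open>e \<subseteq> V\<close> by (auto simp: S_def)
    qed
    have finS: "finite (S v)" for v using finV by (simp add: S_def)
    have "k \<le> card V - 1" using card_mono[OF finS DS[OF v0]] D[OF v0] cS[OF v0] by simp
    then have cV: "card V = k + 1" using n_le k by simp
    have "D v = S v" if "v \<in> V" for v
      using card_subset_eq[OF finS DS[OF that]] D[OF that] cS[OF that] cV by simp
    then have "{v, w} \<in> E" if "v \<in> V" "w \<in> V" "v \<noteq> w" for v w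
      using that by (auto simp: S_def D_def)
    then have "E = {e. e \<subseteq> V \<and> card e = 2}"
      using fsg by (auto simp: finite_simple_graph_def card_2_iff)
    then show ?thesis using finV cV by (simp add: is_complete_graph_def)
  qed
  moreover have "2 * real (card ?Cyc) \<ge> fact k"
    using main by (metis of_nat_fact of_nat_le_iff of_nat_mult of_nat_numeral)
  moreover have "2 * card ?Cyc = fact k" if "2 * real (card ?Cyc) = fact k"
    using that by (metis of_nat_fact of_nat_eq_iff of_nat_mult of_nat_numeral)
  ultimately show ?thesis unfolding G by (auto simp: field_simps)
qed

end
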